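(* Let $\omega\neq0$ be real and $\Delta t>0$ with $\sin(\omega\Delta t)\ne0$, and let $$\alpha=\frac{\omega\Delta t\,(1+\cos(\omega\Delta t))}{2\sin(\omega\Delta t)}.$$ Consider the EF DVD method $\widetilde A_\alpha^{DVD}=\mathbf 0$ for the nonlinear Schr\"odinger equation, where $$\widetilde A_\alpha^{DVD}=\begin{pmatrix}\alpha\,\delta_n^+u_{m,n}+\delta_m^{(2)}\mu_nv_{m,n}+\mu_n(u_{m,n}^2+v_{m,n}^2)\,\mu_nv_{m,n}\\[2pt]-\alpha\,\delta_n^+v_{m,n}+\delta_m^{(2)}\mu_nu_{m,n}+\mu_n(u_{m,n}^2+v_{m,n}^2)\,\mu_nu_{m,n}\end{pmatrix}.$$ This method has discrete conservation laws of charge ($\ell=1$) and energy ($\ell=2$) defined by the identities (valid for arbitrary real grid functions $u_{m,n},v_{m,n}$, so that the left-hand side vanishes on solutions of the method) $$\delta_n^+\widetilde G_\ell+\delta_m^+\widetilde F_\ell=\widetilde C_\ell\,\widetilde A_\alpha^{DVD},\qquad \ell=1,2,$$ with $$\widetilde G_1=\alpha(u_{m,n}^2+v_{m,n}^2),\qquad \widetilde C_1=(2\mu_nu_{m,n},\,-2\mu_nv_{m,n}),$$ $$\widetilde F_1=2(\mu_m\mu_nu_{m-1,n})(\delta_m^-\mu_nv_{m,n})-2(\delta_m^-\mu_nu_{m,n})(\mu_m\mu_nv_{m-1,n}),$$ $$\widetilde F_2=-2(\delta_m^-\mu_nu_{m,n})(\delta_n^+\mu_mu_{m-1,n})-2(\delta_m^-\mu_nv_{m,n})(\delta_n^+\mu_mv_{m-1,n}),$$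 $$\widetilde G_2=\tfrac12\left\{(\delta_m^+u_{m,n})^2+(\delta_m^-u_{m,n})^2+(\delta_m^+v_{m,n})^2+(\delta_m^-v_{m,n})^2\right\}-\tfrac12(u_{m,n}^2+v_{m,n}^2)^2,$$ $$\widetilde C_2=(-2\delta_n^+v_{m,n},\,-2\delta_n^+u_{m,n}).$$
   Context: The nonlinear Schr\"odinger equation $\mathrm iz_t+z_{xx}+|z|^2z=0$ with $z=u+\mathrm iv$ is equivalent to $u_t+v_{xx}+(u^2+v^2)v=0$, $-v_t+u_{xx}+(u^2+v^2)u=0$. On a uniform grid with space step $\Delta x$ and time step $\Delta t$, $u_{m,n}\approx u(x_m,t_n)$, $v_{m,n}\approx v(x_m,t_n)$ are real. Operators acting on any grid function $w_{m,n}$ (including products of grid functions, e.g. $\mu_n(u_{m,n}^2+v_{m,n}^2)$ is the average of $u^2+v^2$ at levels $n$ and $n+1$): $\delta_m^+w_{m,n}=(w_{m+1,n}-w_{m,n})/\Delta x$, $\delta_m^-w_{m,n}=(w_{m,n}-w_{m-1,n})/\Delta x$, $\delta_m^{(2)}w_{m,n}=(w_{m+1,n}-2w_{m,n}+w_{m-1,n})/\Delta x^2$, $\delta_n^+w_{m,n}=(w_{m,n+1}-w_{m,n})/\Delta t$, $\mu_nw_{m,n}=(w_{m,n+1}+w_{m,n})/2$, $\mu_mw_{m,n}=(w_{m+1,n}+w_{m,n})/2$. The product $\widetilde C_\ell\widetilde A$ is that of a row vector and a column vector (a scalar). The functions $\widetilde F_\ell$, $\widetilde G_\ell$, $\widetilde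 C_\ell$ are evaluated at the grid index $(m,n)$. *)

theory Defs
  imports "HOL-Analysis.Analysis"
begin

text \<open>
  Real grid functions \<open>w m n\<close>: the first index is space, the second is time.
  The finite difference and averaging operators map grid functions to grid functions,
  so \<open>\<mu>\<^sub>m\<mu>\<^sub>n w\<close> at the shifted index \<open>(m - 1, n)\<close> reads \<open>mu_m (mu_n w) (m - 1) n\<close>.
\<close>

type_synonym grid = "int \<Rightarrow> int \<Rightarrow> real"

definition dm_plus :: "real \<Rightarrow> grid \<Rightarrow> grid" where
  "dm_plus dx w m n = (w (m + 1) n - w m n) / dx"

definition dm_minus :: "real \<Rightarrow> grid \<Rightarrow> grid" where
  "dm_minus dx w m n = (w m n - w (m - 1) n) / dx"

definition dm_2 :: "real \<Rightarrow> grid \<Rightarrow> grid" where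
  "dm_2 dx w m n = (w (m + 1) n - 2 * w m n + w (m - 1) n) / dx\<^sup>2"

definition dn_plus :: "real \<Rightarrow> grid \<Rightarrow> grid" where
  "dn_plus dt w m n = (w m (n + 1) - w m n) / dt"

definition mu_n :: "grid \<Rightarrow> grid" where
  "mu_n w m n = (w m (n + 1) + w m n) / 2"

definition mu_m :: "grid \<Rightarrow> grid" where
  "mu_m w m n = (w (m + 1) n + w m n) / 2"

definition sq_modulus :: "grid \<Rightarrow> grid \<Rightarrow> grid" where
  "sq_modulus u v m n = (u m n)\<^sup>2 + (v m n)\<^sup>2"

definition A_DVD :: "real \<Rightarrow> real \<Rightarrow> real \<Rightarrow> grid \<Rightarrow> grid \<Rightarrow> int \<Rightarrow> int \<Rightarrow> real^2" where
  "A_DVD \<alpha> dx dt u v m n = vector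
     [ \<alpha> * dn_plus dt u m n + dm_2 dx (mu_n v) m n
         + mu_n (sq_modulus u v) m n * mu_n v m n,
       - \<alpha> * dn_plus dt v m n + dm_2 dx (mu_n u) m n
         + mu_n (sq_modulus u v) m n * mu_n u m n ]"

definition charge_density :: "real \<Rightarrow> grid \<Rightarrow> grid \<Rightarrow> grid" where
  "charge_density \<alpha> u v m n = \<alpha> * ((u m n)\<^sup>2 + (v m n)\<^sup>2)"

definition charge_flux :: "real \<Rightarrow> grid \<Rightarrow> grid \<Rightarrow> grid" where
  "charge_flux dx u v m n =
     2 * mu_m (mu_n u) (m - 1) n * dm_minus dx (mu_n v) m n
   - 2 * dm_minus dx (mu_n u) m n * mu_m (mu_n v) (m - 1) n"

definition charge_char :: "grid \<Rightarrow> grid \<Rightarrow> int \<Rightarrow> int \<Rightarrow> real^2" where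
  "charge_char u v m n = vector [2 * mu_n u m n, - 2 * mu_n v m n]"

definition energy_density :: "real \<Rightarrow> grid \<Rightarrow> grid \<Rightarrow> grid" where
  "energy_density dx u v m n =
     1 / 2 * ((dm_plus dx u m n)\<^sup>2 + (dm_minus dx u m n)\<^sup>2
            + (dm_plus dx v m n)\<^sup>2 + (dm_minus dx v m n)\<^sup>2)
   - 1 / 2 * ((u m n)\<^sup>2 + (v m n)\<^sup>2)\<^sup>2"

definition energy_flux :: "real \<Rightarrow> real \<Rightarrow> grid \<Rightarrow> grid \<Rightarrow> grid" where
  "energy_flux dx dt u v m n =
   - 2 * dm_minus dx (mu_n u) m n * dn_plus dt (mu_m u) (m - 1) n
   - 2 * dm_minus dx (mu_n v) m n * dn_plus dt (mu_m v) (m - 1) n"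

definition energy_char :: "real \<Rightarrow> grid \<Rightarrow> grid \<Rightarrow> int \<Rightarrow> int \<Rightarrow> real^2" where
  "energy_char dt u v m n = vector [- 2 * dn_plus dt v m n, - 2 * dn_plus dt u m n]"

definition discrete_divergence ::
  "real \<Rightarrow> real \<Rightarrow> (grid \<Rightarrow> grid \<Rightarrow> grid) \<Rightarrow> (grid \<Rightarrow> grid \<Rightarrow> grid) \<Rightarrow> grid \<Rightarrow> grid \<Rightarrow> grid" where
  "discrete_divergence dx dt G F u v m n = dn_plus dt (G u v) m n + dm_plus dx (F u v) m n"

definition method_solution ::
  "(grid \<Rightarrow> grid \<Rightarrow> int \<Rightarrow> int \<Rightarrow> real^2) \<Rightarrow> grid \<Rightarrow> grid \<Rightarrow> bool" where
  "method_solution A u v \<longleftrightarrow> (\<forall>m n. A u v m n = 0)"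

definition discrete_conservation_law ::
  "real \<Rightarrow> real \<Rightarrow> (grid \<Rightarrow> grid \<Rightarrow> int \<Rightarrow> int \<Rightarrow> real^2) \<Rightarrow>
   (grid \<Rightarrow> grid \<Rightarrow> grid) \<Rightarrow> (grid \<Rightarrow> grid \<Rightarrow> grid) \<Rightarrow> bool" where
  "discrete_conservation_law dx dt A G F \<longleftrightarrow>
     (\<forall>u v. method_solution A u v \<longrightarrow> (\<forall>m n. discrete_divergence dx dt G F u v m n = 0))"

end

theory Submission
  imports Defs
begin

text \<open>
  Both conservation laws are discrete counterparts of the continuous computation in which one
  multiplies the equation by a characteristic and applies the product rule. The time scheme is
  built so that the product rule survives exactly: \<open>\<delta>\<^sub>n\<^sup>+ (w\<^sup>2) = 2 (\<mu>\<^sub>n w) (\<delta>\<^sub>n\<^sup>+ w)\<close> (lemma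
  \<open>dn_plus_square\<close>), and in space it is replaced by a symmetric summation by parts (lemma
  \<open>dm_plus_mean_times_difference\<close>), which turns the difference of the flux
  \<open>(mean of p) * \<delta>\<^sub>m\<^sup>- q\<close> into \<open>p\<close> times the second difference of \<open>q\<close> plus the average of
  \<open>\<delta>\<^sub>m\<^sup>+ p * \<delta>\<^sub>m\<^sup>+ q\<close> and \<open>\<delta>\<^sub>m\<^sup>- p * \<delta>\<^sub>m\<^sup>- q\<close>.

  For the charge, the flux is antisymmetric in \<open>p = \<mu>\<^sub>n u\<close> and \<open>q = \<mu>\<^sub>n v\<close>, so the symmetric gradient
  terms cancel and only the second differences remain; the cubic terms of the scheme cancel in the
  product with the characteristic.

  For the energy, one takes \<open>q = \<mu>\<^sub>n u\<close> and \<open>p = \<delta>\<^sub>n\<^sup>+ u\<close> (and likewise for \<open>v\<close>). The gradient terms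
  left over by the summation by parts cancel against the time difference of the gradient part of
  the energy, which is why that density averages forward and backward differences. The quartic part
  is handled by using the product rule twice, first on \<open>(u\<^sup>2 + v\<^sup>2)\<^sup>2\<close> and then on \<open>u\<^sup>2 + v\<^sup>2\<close>.
  The terms of the scheme with \<open>\<alpha>\<close> cancel in the product with the characteristic.

  Each of the two identities gives a conservation law, because the scheme is a factor of its
  right-hand side, which therefore vanishes on solutions.
\<close>

lemma dn_plus_square:
  "dn_plus dt (\<lambda>m n. (w m n)\<^sup>2) m n = 2 * mu_n w m n * dn_plus dt w m n"
  by (simp add: dn_plus_def mu_n_def power2_eq_square algebra_simps diff_divide_distrib)

lemma dn_plus_add:
  "dn_plus dt (\<lambda>m n. w m n + z m n) m n = dn_plus dt w m n + dn_plus dt z m n"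
  by (simp add: dn_plus_def diff_divide_distrib add_divide_distrib)

lemma dn_plus_diff:
  "dn_plus dt (\<lambda>m n. w m n - z m n) m n = dn_plus dt w m n - dn_plus dt z m n"
  by (simp add: dn_plus_def diff_divide_distrib)

lemma dn_plus_cmult:
  "dn_plus dt (\<lambda>m n. c * w m n) m n = c * dn_plus dt w m n"
  by (simp add: dn_plus_def right_diff_distrib)

lemma dm_plus_add:
  "dm_plus dx (\<lambda>m n. w m n + z m n) m n = dm_plus dx w m n + dm_plus dx z m n"
  by (simp add: dm_plus_def diff_divide_distrib add_divide_distrib)

lemma dm_plus_diff:
  "dm_plus dx (\<lambda>m n. w m n - z m n) m n = dm_plus dx w m n - dm_plus dx z m n"
  by (simp add: dm_plus_def diff_divide_distrib)

lemma dm_plus_cmult: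
  "dm_plus dx (\<lambda>m n. c * w m n) m n = c * dm_plus dx w m n"
  by (simp add: dm_plus_def right_diff_distrib)

lemma mu_n_dm_plus: "mu_n (dm_plus dx w) = dm_plus dx (mu_n w)"
  by (intro ext) (simp add: mu_n_def dm_plus_def add_divide_distrib diff_divide_distrib)

lemma mu_n_dm_minus: "mu_n (dm_minus dx w) = dm_minus dx (mu_n w)"
  by (intro ext) (simp add: mu_n_def dm_minus_def add_divide_distrib diff_divide_distrib)

lemma dn_plus_dm_plus: "dn_plus dt (dm_plus dx w) = dm_plus dx (dn_plus dt w)"
  by (intro ext) (simp add: dn_plus_def dm_plus_def diff_divide_distrib mult.commute)

lemma dn_plus_dm_minus: "dn_plus dt (dm_minus dx w) = dm_minus dx (dn_plus dt w)"
  by (intro ext) (simp add: dn_plus_def dm_minus_def diff_divide_distrib mult.commute)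

lemma dn_plus_mu_m: "dn_plus dt (mu_m w) = mu_m (dn_plus dt w)"
  by (intro ext) (simp add: dn_plus_def mu_m_def add_divide_distrib diff_divide_distrib)

text \<open>
  At the two ends of the cell the mean of \<open>p\<close> is \<open>p m n\<close> corrected by half a one-sided difference:
  the common value \<open>p m n\<close> collects the second difference of \<open>q\<close>, the corrections give the
  gradient products.
\<close>

lemma dm_plus_mean_times_difference:
  "dm_plus dx (\<lambda>m n. mu_m p (m - 1) n * dm_minus dx q m n) m n
     = p m n * dm_2 dx q m n
       + (dm_plus dx p m n * dm_plus dx q m n + dm_minus dx p m n * dm_minus dx q m n) / 2"
proof (cases "dx = 0")
  case True
  then show ?thesis
    by (simp add: dm_plus_def dm_minus_def dm_2_def)
next
  case False
  then show ?thesis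
    by (simp add: dm_plus_def dm_minus_def dm_2_def mu_m_def power2_eq_square field_simps)
qed

lemma inner_vector_2: "(vector [a, b] :: real^2) \<bullet> vector [c, d] = a * c + b * d"
  by (simp add: inner_vec_def sum_2)

lemma dn_plus_charge_density:
  "dn_plus dt (charge_density \<alpha> u v) m n
     = 2 * \<alpha> * (mu_n u m n * dn_plus dt u m n + mu_n v m n * dn_plus dt v m n)"
proof -
  have "charge_density \<alpha> u v = (\<lambda>m n. \<alpha> * ((u m n)\<^sup>2 + (v m n)\<^sup>2))"
    by (intro ext) (simp add: charge_density_def)
  then show ?thesis
    by (simp add: dn_plus_cmult dn_plus_add dn_plus_square algebra_simps)
qed

lemma dm_plus_charge_flux:
  "dm_plus dx (charge_flux dx u v) m n
     = 2 * (mu_n u m n * dm_2 dx (mu_n v) m n - mu_n v m n * dm_2 dx (mu_n u) m n)"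
proof -
  have "charge_flux dx u v = (\<lambda>m n.
      2 * (mu_m (mu_n u) (m - 1) n * dm_minus dx (mu_n v) m n
         - mu_m (mu_n v) (m - 1) n * dm_minus dx (mu_n u) m n))"
    by (intro ext) (simp add: charge_flux_def algebra_simps)
  then show ?thesis
    by (simp only: dm_plus_cmult dm_plus_diff dm_plus_mean_times_difference)
       (simp add: algebra_simps)
qed

lemma charge_identity:
  "dn_plus dt (charge_density \<alpha> u v) m n + dm_plus dx (charge_flux dx u v) m n
     = charge_char u v m n \<bullet> A_DVD \<alpha> dx dt u v m n"
  by (simp add: dn_plus_charge_density dm_plus_charge_flux charge_char_def A_DVD_def
      inner_vector_2 algebra_simps)

lemma dn_plus_energy_density:
  "dn_plus dt (energy_density dx u v) m n
     = dm_plus dx (mu_n u) m n * dm_plus dx (dn_plus dt u) m n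
     + dm_minus dx (mu_n u) m n * dm_minus dx (dn_plus dt u) m n
     + dm_plus dx (mu_n v) m n * dm_plus dx (dn_plus dt v) m n
     + dm_minus dx (mu_n v) m n * dm_minus dx (dn_plus dt v) m n
     - 2 * mu_n (sq_modulus u v) m n
         * (mu_n u m n * dn_plus dt u m n + mu_n v m n * dn_plus dt v m n)"
proof -
  have density: "energy_density dx u v = (\<lambda>m n.
      1 / 2 * ((dm_plus dx u m n)\<^sup>2 + (dm_minus dx u m n)\<^sup>2
             + (dm_plus dx v m n)\<^sup>2 + (dm_minus dx v m n)\<^sup>2)
      - 1 / 2 * (sq_modulus u v m n)\<^sup>2)"
    by (intro ext) (simp add: energy_density_def sq_modulus_def)
  have "sq_modulus u v = (\<lambda>m n. (u m n)\<^sup>2 + (v m n)\<^sup>2)"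
    by (intro ext) (simp add: sq_modulus_def)
  then have modulus: "dn_plus dt (sq_modulus u v) m n
      = 2 * (mu_n u m n * dn_plus dt u m n + mu_n v m n * dn_plus dt v m n)"
    by (simp add: dn_plus_add dn_plus_square)
  show ?thesis
    unfolding density dn_plus_diff dn_plus_cmult dn_plus_add dn_plus_square modulus
      mu_n_dm_plus mu_n_dm_minus dn_plus_dm_plus dn_plus_dm_minus
    by (simp add: algebra_simps)
qed

text \<open>
  The flux carries a time difference of a space mean; the two operators commute, which puts it in
  the form that the summation by parts needs.
\<close>

lemma dm_plus_energy_flux:
  "dm_plus dx (energy_flux dx dt u v) m n
     = - 2 * (dn_plus dt u m n * dm_2 dx (mu_n u) m n + dn_plus dt v m n * dm_2 dx (mu_n v) m n)
     - dm_plus dx (mu_n u) m n * dm_plus dx (dn_plus dt u) m n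
     - dm_minus dx (mu_n u) m n * dm_minus dx (dn_plus dt u) m n
     - dm_plus dx (mu_n v) m n * dm_plus dx (dn_plus dt v) m n
     - dm_minus dx (mu_n v) m n * dm_minus dx (dn_plus dt v) m n"
proof -
  have flux: "energy_flux dx dt u v = (\<lambda>m n.
      - 2 * (mu_m (dn_plus dt u) (m - 1) n * dm_minus dx (mu_n u) m n
           + mu_m (dn_plus dt v) (m - 1) n * dm_minus dx (mu_n v) m n))"
    by (intro ext) (simp add: energy_flux_def dn_plus_mu_m algebra_simps)
  show ?thesis
    unfolding flux dm_plus_cmult dm_plus_add dm_plus_mean_times_difference
    by (simp add: field_simps)
qed

lemma energy_identity:
  "dn_plus dt (energy_density dx u v) m n + dm_plus dx (energy_flux dx dt u v) m n
     = energy_char dt u v m n \<bullet> A_DVD \<alpha> dx dt u v m n"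
  by (simp add: dn_plus_energy_density dm_plus_energy_flux energy_char_def A_DVD_def
      inner_vector_2 algebra_simps)

lemma discrete_conservation_law_of_characteristic:
  assumes "\<And>u v m n. dn_plus dt (G u v) m n + dm_plus dx (F u v) m n = C u v m n \<bullet> A u v m n"
  shows "discrete_conservation_law dx dt A G F"
  using assms
  by (simp add: discrete_conservation_law_def discrete_divergence_def method_solution_def)

theorem theorem3:
  fixes \<omega> dt dx \<alpha> :: real
  assumes "\<omega> \<noteq> 0" and "dt > 0" and "dx > 0" and "sin (\<omega> * dt) \<noteq> 0"
    and "\<alpha> = \<omega> * dt * (1 + cos (\<omega> * dt)) / (2 * sin (\<omega> * dt))"
  shows
    "(\<forall>u v m n.
        dn_plus dt (charge_density \<alpha> u v) m n + dm_plus dx (charge_flux dx u v) m n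
          = charge_char u v m n \<bullet> A_DVD \<alpha> dx dt u v m n) \<and>
     (\<forall>u v m n.
        dn_plus dt (energy_density dx u v) m n + dm_plus dx (energy_flux dx dt u v) m n
          = energy_char dt u v m n \<bullet> A_DVD \<alpha> dx dt u v m n) \<and>
     discrete_conservation_law dx dt (A_DVD \<alpha> dx dt) (charge_density \<alpha>) (charge_flux dx) \<and>
     discrete_conservation_law dx dt (A_DVD \<alpha> dx dt) (energy_density dx) (energy_flux dx dt)"
proof (intro conjI)
  show "discrete_conservation_law dx dt (A_DVD \<alpha> dx dt) (charge_density \<alpha>) (charge_flux dx)"
    by (rule discrete_conservation_law_of_characteristic) (rule charge_identity)
  show "discrete_conservation_law dx dt (A_DVD \<alpha> dx dt) (energy_density dx) (energy_flux dx dt)"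
    by (rule discrete_conservation_law_of_characteristic) (rule energy_identity)
qed (intro allI charge_identity energy_identity)+

end
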